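(* Let $Q\subset E$ be convex, $f:Q\to\mathbb{R}$ convex, $L>0$, $\delta_k\ge 0$ for $k\ge 0$, and suppose that for every $k\ge 0$ and every $y\in Q$ there is a $(\delta_k,L)$-model $\psi_{\delta_k}(\cdot,y)$ of $f$ at $y$ with respect to $V[y](x)$, with approximate values $f_{\delta_k}(y)$. Let $x_0\in Q$, $0<L_0\le L$, and let $x_*$ be the minimizer of $f$ on $Q$ nearest to $x_0$ in the sense of the Bregman divergence $V[x_0](\cdot)$; assume $V[x_0](x_* )\le R^2$. Let $(x_k)$, $(\alpha_k)$, $(A_k)$, $(L_k)$ be generated by the adaptive gradient method described in the context, and let $\bar x_N=\frac{1}{A_N}\sum_{k=0}^{N-1}\alpha_{k+1}x_{k+1}$. Then $$f(\bar x_N)-f(x_* )\le \frac{R^2}{A_N}+\frac{2}{A_N}\sum_{k=0}^{N-1}\alpha_{k+1}\delta_k\le \frac{2LR^2}{N}+\frac{2}{A_N}\sum_{k=0}^{N-1}\alpha_{k+1}\delta_k,$$ where $A_N\ge \frac{N}{2L}$. Moreover, the total number of attempts to solve the auxiliary minimization problem (during the first $N$ iterations) is bounded by $2N+\log_2\frac{L}{L_0}$.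
   Context: $E$ is a finite-dimensional real vector space. $d$ is a convex differentiable function on $Q$ and $V[y](x)=d(x)-d(y)-\langle\nabla d(y),x-y\rangle$ (strong convexity of $d$ is not assumed). Model. For $\delta\ge 0$, $L>0$, $\psi_\delta(x,y)$ is a $(\delta,L)$-model of $f$ at $y\in Q$ w.r.t. $V[y](x)$ if there is a number $f_\delta(y)\in[f(y)-\delta,f(y)]$ such that for all $x\in Q$ $$0\le f(x)-\bigl(f_\delta(y)+\psi_\delta(x,y)\bigr)\le L\,V[y](x)+\delta,$$ $\psi_\delta(x,y)$ is convex in $x\in Q$, and $\psi_\delta(x,x)=0$ for all $x\in Q$. Adaptive gradient method. Input: starting point $x_0$, the sequence $\{\delta_k\}_{k\ge0}$, and $L_0$. Put $\alpha_0=A_0=0$. For $k=0,1,2,\dots$: find the smallest integer $i_k\ge 0$ such that, with $L_{k+1}=2^{i_k-1}L_k$, $\alpha_{k+1}=1/L_{k+1}$, $A_{k+1}=A_k+\alpha_{k+1}$ and $$x_{k+1}=\arg\min_{x\in Q}\ L_{k+1}\bigl(V[x_k](x)+\alpha_{k+1}\psi_{\delta_k}(x,x_k)\bigr)$$ (the auxiliary problem), one has $$f_{\delta_k}(x_{k+1})\le f_{\delta_k}(x_k)+\psi_{\delta_k}(x_{k+1},x_k)+L_{k+1}V[x_k](x_{k+1})+\delta_k .$$ Each trial value of $i_k$ requires one attempt to solve the auxiliary problem.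
   Formalization: The bound on the total number of attempts is proved as 2N + ⌈log₂(L/L₀)⌉; the printed bound 2N + log₂(L/L₀) fails, e.g. for f(t)=d(t)=t²/2 on ℝ, ψ(u,y)=y(u−y), δ=0, L=1, L₀=3/4, x₀=1, N=1 (3 attempts). *)

theory Defs
  imports "HOL-Analysis.Analysis"
begin

text \<open>
  The pairing of the gradient of \<open>d\<close> with a vector is the derivative of \<open>d\<close> applied to that
  vector. For \<open>Q\<close> with empty interior, the derivative at \<open>y\<close> within \<open>Q\<close> is not unique as a linear
  functional; but for convex \<open>Q\<close>, \<open>d\<close> differentiable on \<open>Q\<close> and \<open>x, y \<in> Q\<close>, its value at \<open>x - y\<close> is
  the derivative of \<open>d\<close> along the segment from \<open>y\<close> to \<open>x\<close>, so \<open>bregman Q d y x\<close>, the V[y](x) of the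
  literature, does not depend on the choice.
\<close>

definition bregman ::
  "'a::real_normed_vector set \<Rightarrow> ('a \<Rightarrow> real) \<Rightarrow> 'a \<Rightarrow> 'a \<Rightarrow> real" where
  "bregman Q d y x = d x - d y - frechet_derivative d (at y within Q) (x - y)"

text \<open>
  \<open>\<psi>\<close> is a (\<open>\<delta>\<close>, \<open>L\<close>)-model of \<open>f\<close> at \<open>y\<close> with respect to \<open>V\<close>, and \<open>v\<close> is a witness for the
  approximate value of \<open>f\<close> at \<open>y\<close>. The witness is exposed because the method below uses it.
\<close>

definition inexact_model ::
  "('a::real_vector \<Rightarrow> 'a \<Rightarrow> real) \<Rightarrow> 'a set \<Rightarrow> ('a \<Rightarrow> real) \<Rightarrow> real \<Rightarrow> real \<Rightarrow> 'a
    \<Rightarrow> real \<Rightarrow> ('a \<Rightarrow> 'a \<Rightarrow> real) \<Rightarrow> bool" where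
  "inexact_model V Q f \<delta> L y v \<psi> \<longleftrightarrow>
     v \<in> {f y - \<delta>..f y} \<and>
     (\<forall>x\<in>Q. 0 \<le> f x - (v + \<psi> x y) \<and> f x - (v + \<psi> x y) \<le> L * V y x + \<delta>) \<and>
     convex_on Q (\<lambda>x. \<psi> x y) \<and>
     (\<forall>x\<in>Q. \<psi> x x = 0)"

definition solves_auxiliary ::
  "('a \<Rightarrow> 'a \<Rightarrow> real) \<Rightarrow> 'a set \<Rightarrow> ('a \<Rightarrow> 'a \<Rightarrow> real) \<Rightarrow> real \<Rightarrow> 'a \<Rightarrow> 'a \<Rightarrow> bool" where
  "solves_auxiliary V Q \<psi> M y u \<longleftrightarrow>
     is_arg_min (\<lambda>x. M * (V y x + (1 / M) * \<psi> x y)) (\<lambda>x. x \<in> Q) u"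

definition accepted ::
  "('a \<Rightarrow> 'a \<Rightarrow> real) \<Rightarrow> ('a \<Rightarrow> 'a \<Rightarrow> real) \<Rightarrow> ('a \<Rightarrow> real) \<Rightarrow> real \<Rightarrow> real \<Rightarrow> 'a \<Rightarrow> 'a \<Rightarrow> bool" where
  "accepted V \<psi> v \<delta> M y u \<longleftrightarrow> v u \<le> v y + \<psi> u y + M * V y u + \<delta>"

text \<open>
  \<open>z k j\<close> is the solution of the auxiliary problem returned in trial \<open>j\<close> of iteration \<open>k\<close> (minimizers
  need not be unique). Solvability is required only for trials that are actually reached, i.e. those
  for which all earlier trials of the same iteration have been rejected. That some trial is
  eventually accepted, so that the least index \<open>i k\<close> is well defined, is not assumed: it follows
  from the model inequalities.
\<close>

definition adaptive_gradient_method ::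
  "('a \<Rightarrow> 'a \<Rightarrow> real) \<Rightarrow> 'a set \<Rightarrow> (nat \<Rightarrow> real) \<Rightarrow> (nat \<Rightarrow> 'a \<Rightarrow> 'a \<Rightarrow> real) \<Rightarrow> (nat \<Rightarrow> 'a \<Rightarrow> real)
    \<Rightarrow> (nat \<Rightarrow> nat \<Rightarrow> 'a) \<Rightarrow> (nat \<Rightarrow> nat) \<Rightarrow> (nat \<Rightarrow> 'a) \<Rightarrow> (nat \<Rightarrow> real) \<Rightarrow> (nat \<Rightarrow> real) \<Rightarrow> (nat \<Rightarrow> real)
    \<Rightarrow> bool" where
  "adaptive_gradient_method V Q \<delta> \<psi> v z i x \<alpha> A Ls \<longleftrightarrow>
     \<alpha> 0 = 0 \<and> A 0 = 0 \<and>
     (\<forall>k. let trial_L = (\<lambda>j. 2 powi (int j - 1) * Ls k);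
              ok = (\<lambda>j. accepted V (\<psi> k) (v k) (\<delta> k) (trial_L j) (x k) (z k j))
          in (\<forall>j. (\<forall>j'<j. \<not> ok j') \<longrightarrow> solves_auxiliary V Q (\<psi> k) (trial_L j) (x k) (z k j)) \<and>
             i k = (LEAST j. ok j) \<and>
             Ls (Suc k) = trial_L (i k) \<and>
             \<alpha> (Suc k) = 1 / Ls (Suc k) \<and>
             A (Suc k) = A k + \<alpha> (Suc k) \<and>
             x (Suc k) = z k (i k))"

text \<open>
  Iteration \<open>k\<close> tries \<open>0, ..., i k\<close>. An upper bound for the number of attempts needs
  \<open>\<lceil>log 2 (L / Ls 0)\<rceil>\<close>, not \<open>log 2 (L / Ls 0)\<close>, since the last accepted constant may exceed \<open>L\<close> (by
  a factor less than 2): with \<open>f t = d t = t\<^sup>2 / 2\<close> on the real line, \<open>\<psi> u y = y * (u - y)\<close>,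
  \<open>\<delta> = 0\<close>, \<open>L = 1\<close>, \<open>Ls 0 = 3 / 4\<close>, \<open>x 0 = 1\<close>, the first iteration rejects 3/8 and 3/4 and accepts
  3/2, that is 3 attempts, whereas \<open>2 + log 2 (4 / 3) < 3\<close>.
\<close>

definition attempts :: "(nat \<Rightarrow> nat) \<Rightarrow> nat \<Rightarrow> nat" where
  "attempts i N = (\<Sum>k<N. i k + 1)"

end

theory Submission
  imports Defs
begin

text \<open>
  Minimality of \<open>x (Suc k)\<close> along segments and the three-point identity for \<open>V\<close> give
  \<open>\<psi> w + M V y w \<ge> \<psi> u + M V y u + M V u w\<close>. With the acceptance test and the two sides of the
  model inequality this turns into
  \<open>\<alpha> (Suc k) (f (x (Suc k)) - f w) \<le> V (x k) w - V (x (Suc k)) w + 2 \<alpha> (Suc k) \<delta> k\<close>, which telescopes.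
  A trial with constant at least \<open>L\<close> is always accepted, so every accepted constant is below \<open>2 L\<close>;
  the number of attempts is then read off from
  \<open>Ls N = 2 powi (attempts - 2 N) * Ls 0\<close>.
\<close>

text \<open>By convexity the segment from \<open>y\<close> to \<open>x\<close> lies in
  \<open>Q\<close>, so the chain rule along it yields a one-sided derivative equal to
  \<open>D (x - y)\<close>. This also covers a \<open>Q\<close> with empty interior: the limit is
  the same for every derivative \<open>D\<close> of \<open>d\<close> within \<open>Q\<close>,
  whichever one \<open>frechet_derivative\<close> picks.\<close>

lemma directional_difference_quotient_tendsto:
  fixes d :: "'a::real_normed_vector \<Rightarrow> real"
  assumes Q: "convex Q" "y \<in> Q" "x \<in> Q"
    and D: "(d has_derivative D) (at y within Q)"
  shows "((\<lambda>t. (d (y + t *\<^sub>R (x - y)) - d y) / t) \<longlongrightarrow> D (x - y)) (at_right 0)"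
proof -
  let ?g = "\<lambda>t::real. y + t *\<^sub>R (x - y)"
  have sub: "?g ` {0..1} \<subseteq> Q"
  proof safe
    fix t :: real assume t: "t \<in> {0..1}"
    have "(1 - t) *\<^sub>R y + t *\<^sub>R x \<in> Q"
      using t Q by (intro convexD) auto
    thus "?g t \<in> Q" by (simp add: algebra_simps)
  qed
  have "(?g has_derivative (\<lambda>h. h *\<^sub>R (x - y))) (at 0 within {0..1})"
    by (auto intro!: derivative_eq_intros)
  moreover have "(d has_derivative D) (at (?g 0) within ?g ` {0..1})"
    using has_derivative_subset[OF D sub] by simp
  ultimately have "(d \<circ> ?g has_derivative D \<circ> (\<lambda>h. h *\<^sub>R (x - y))) (at 0 within {0..1})"
    by (rule diff_chain_within)
  moreover have "D \<circ> (\<lambda>h. h *\<^sub>R (x - y)) = (*) (D (x - y))"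
    using linear_scale[OF has_derivative_linear[OF D]] by (auto simp: o_def)
  ultimately have "(d \<circ> ?g has_real_derivative D (x - y)) (at 0 within {0..1})"
    by (simp add: has_field_derivative_def)
  thus ?thesis
    by (simp add: has_field_derivative_iff at_within_Icc_at_right)
qed

text \<open>Convexity bounds each difference quotient of \<open>d\<close> along the segment by
  \<open>d x - d y\<close>; letting t tend to 0 gives the gradient inequality.\<close>

lemma bregman_nonneg:
  assumes "convex Q" "convex_on Q d" "d differentiable_on Q" "y \<in> Q" "x \<in> Q"
  shows "bregman Q d y x \<ge> 0"
proof -
  let ?D = "frechet_derivative d (at y within Q)"
  have D: "(d has_derivative ?D) (at y within Q)"
    using assms by (simp add: differentiable_on_def frechet_derivative_works)
  have "\<forall>\<^sub>F t in at_right 0. (d (y + t *\<^sub>R (x - y)) - d y) / t \<le> d x - d y"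
    unfolding eventually_at_right_field
  proof (intro exI[of _ 1] conjI allI impI)
    fix t :: real assume t: "0 < t" "t < 1"
    have "d ((1 - t) *\<^sub>R y + t *\<^sub>R x) \<le> (1 - t) * d y + t * d x"
      using assms t by (intro convex_onD) auto
    thus "(d (y + t *\<^sub>R (x - y)) - d y) / t \<le> d x - d y"
      using t by (simp add: field_simps)
  qed simp
  hence "?D (x - y) \<le> d x - d y"
    by (rule tendsto_upperbound[OF
          directional_difference_quotient_tendsto[OF assms(1,4,5) D]]) simp
  thus ?thesis by (simp add: bregman_def)
qed

text \<open>First-order optimality of \<open>u\<close>, obtained by comparing \<open>u\<close> with
  nearby points on the segment towards \<open>w\<close>. Convexity bounds \<open>\<psi>\<close>
  along that segment, so only \<open>d\<close> is differentiated and no subgradient of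
  \<open>\<psi>\<close> occurs.\<close>

lemma solves_auxiliary_three_point:
  assumes "convex Q" "d differentiable_on Q" "y \<in> Q" "w \<in> Q" "M > 0"
    and \<psi>: "convex_on Q (\<lambda>x. \<psi> x y)"
    and sol: "solves_auxiliary (bregman Q d) Q \<psi> M y u"
  shows "\<psi> u y + M * bregman Q d y u + M * bregman Q d u w \<le> \<psi> w y + M * bregman Q d y w"
proof -
  let ?Dy = "frechet_derivative d (at y within Q)"
  let ?Du = "frechet_derivative d (at u within Q)"
  have uQ: "u \<in> Q"
    and min: "\<And>x. x \<in> Q \<Longrightarrow> M * bregman Q d y u + \<psi> u y \<le> M * bregman Q d y x + \<psi> x y"
    using sol \<open>M > 0\<close>
    by (auto simp: solves_auxiliary_def is_arg_min_def not_less distrib_left)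
  have Du: "(d has_derivative ?Du) (at u within Q)" and Dy: "(d has_derivative ?Dy) (at y within Q)"
    using assms uQ by (simp_all add: differentiable_on_def frechet_derivative_works)
  note lin = has_derivative_linear[OF Dy]
  \<comment> \<open>Dividing the minimality inequality by \<open>M * t\<close> isolates the
    difference quotient of \<open>d\<close> at \<open>u\<close>; the other side is independent of t,
    so the bound survives the limit.\<close>
  have "\<forall>\<^sub>F t in at_right 0.
      ?Dy (w - u) - (\<psi> w y - \<psi> u y) / M \<le> (d (u + t *\<^sub>R (w - u)) - d u) / t"
    unfolding eventually_at_right_field
  proof (intro exI[of _ 1] conjI allI impI)
    fix t :: real assume t: "0 < t" "t < 1"
    let ?p = "u + t *\<^sub>R (w - u)"
    have p: "?p = (1 - t) *\<^sub>R u + t *\<^sub>R w" by (simp add: algebra_simps)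
    have "?p \<in> Q" unfolding p using assms uQ t by (intro convexD) auto
    from min[OF this] have "M * bregman Q d y u + \<psi> u y \<le> M * bregman Q d y ?p + \<psi> ?p y" .
    also have "\<psi> ?p y \<le> (1 - t) * \<psi> u y + t * \<psi> w y"
      unfolding p using \<psi> uQ assms t by (intro convex_onD[OF \<psi>]) auto
    finally have "0 \<le> M * (bregman Q d y ?p - bregman Q d y u) + t * (\<psi> w y - \<psi> u y)"
      by (simp add: algebra_simps)
    also have "bregman Q d y ?p - bregman Q d y u = d ?p - d u - t * ?Dy (w - u)"
    proof -
      have "?p - y = (u - y) + t *\<^sub>R (w - u)" by simp
      hence "?Dy (?p - y) = ?Dy (u - y) + t * ?Dy (w - u)"
        by (simp only: linear_add[OF lin] linear_scale[OF lin]) simp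
      thus ?thesis by (simp add: bregman_def)
    qed
    finally show "?Dy (w - u) - (\<psi> w y - \<psi> u y) / M \<le> (d ?p - d u) / t"
      using t \<open>M > 0\<close> by (simp add: field_simps)
  qed simp
  hence "?Dy (w - u) - (\<psi> w y - \<psi> u y) / M \<le> ?Du (w - u)"
    by (rule tendsto_lowerbound[OF
          directional_difference_quotient_tendsto[OF assms(1) uQ assms(4) Du]]) simp
  hence "M * (?Dy (w - u) - ?Du (w - u)) \<le> \<psi> w y - \<psi> u y"
    using \<open>M > 0\<close> by (simp add: field_simps)
  moreover have "?Dy (w - y) = ?Dy (w - u) + ?Dy (u - y)"
    by (simp flip: linear_add[OF lin])
  \<comment> \<open>The three-point identity for the Bregman divergence; its last bracket is the
    quantity just bounded by optimality.\<close>
  hence "bregman Q d y w = bregman Q d y u + bregman Q d u w + (?Du (w - u) - ?Dy (w - u))"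
    by (simp add: bregman_def)
  hence "M * bregman Q d y w = M * bregman Q d y u + M * bregman Q d u w
      + M * (?Du (w - u) - ?Dy (w - u))"
    by (simp add: distrib_left)
  ultimately show ?thesis by (simp add: right_diff_distrib)
qed

text \<open>The model at \<open>u\<close> gives \<open>v u\<close> \<le> \<open>f u\<close>, and the
  upper model inequality at \<open>y\<close> bounds \<open>f u\<close>. Nonnegativity of
  \<open>V y u\<close> allows \<open>L\<close> to be replaced by the larger
  \<open>M\<close>.\<close>

lemma accepted_if_constant_ge:
  assumes mu: "inexact_model V Q f \<delta> L u (v u) \<psi>" and my: "inexact_model V Q f \<delta> L y (v y) \<psi>"
    and "u \<in> Q" "V y u \<ge> 0" "L \<le> M"
  shows "accepted V \<psi> v \<delta> M y u"
proof -
  have "v u \<le> f u" using mu by (simp add: inexact_model_def)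
  also have "f u \<le> v y + \<psi> u y + L * V y u + \<delta>"
    using my \<open>u \<in> Q\<close> by (fastforce simp: inexact_model_def)
  also have "L * V y u \<le> M * V y u"
    using assms by (intro mult_right_mono)
  finally show ?thesis by (simp add: accepted_def)
qed

text \<open>One iteration preserves the invariant that the iterate lies in \<open>Q\<close> and the
  constant lies strictly between 0 and \<open>2 * L\<close>. The bound is \<open>2 * L\<close>
  rather than \<open>L\<close> because doubling may overshoot \<open>L\<close>.\<close>

lemma adaptive_step:
  assumes mod: "\<And>y. y \<in> Q \<Longrightarrow> inexact_model V Q f (\<delta> k) L y (v k y) (\<psi> k)"
    and nonneg: "\<And>y u. y \<in> Q \<Longrightarrow> u \<in> Q \<Longrightarrow> V y u \<ge> 0"
    and run: "adaptive_gradient_method V Q \<delta> \<psi> v z i x \<alpha> A Ls"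
    and xQ: "x k \<in> Q" and pos: "Ls k > 0" and less: "Ls k < 2 * L"
  shows "solves_auxiliary V Q (\<psi> k) (Ls (Suc k)) (x k) (x (Suc k))"
    and "accepted V (\<psi> k) (v k) (\<delta> k) (Ls (Suc k)) (x k) (x (Suc k))"
    and "x (Suc k) \<in> Q" and "Ls (Suc k) > 0" and "Ls (Suc k) < 2 * L"
proof -
  define T where "T j = 2 powi (int j - 1) * Ls k" for j
  define ok where "ok j = accepted V (\<psi> k) (v k) (\<delta> k) (T j) (x k) (z k j)" for j
  have sol: "solves_auxiliary V Q (\<psi> k) (T j) (x k) (z k j)" if "\<And>j'. j' < j \<Longrightarrow> \<not> ok j'" for j
    using run that unfolding adaptive_gradient_method_def Let_def ok_def T_def by blast
  have ik: "i k = (LEAST j. ok j)" and L1: "Ls (Suc k) = T (i k)" and x1: "x (Suc k) = z k (i k)"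
    using run unfolding adaptive_gradient_method_def Let_def ok_def T_def by blast+
  \<comment> \<open>A trial is known to return a minimizer only when all earlier trials were
    rejected, so this premise is carried along.\<close>
  have ok_large: "ok j" if "\<And>j'. j' < j \<Longrightarrow> \<not> ok j'" "L \<le> T j" for j
  proof -
    have "z k j \<in> Q" using sol[OF that(1)] by (simp add: solves_auxiliary_def is_arg_min_def)
    thus ?thesis unfolding ok_def
      using mod nonneg xQ that(2) by (intro accepted_if_constant_ge) auto
  qed
  have T_Suc: "T (Suc j) = 2 ^ j * Ls k" for j by (simp add: T_def)
  obtain n :: nat where "L / Ls k < 2 ^ n" using real_arch_pow[of 2] by auto
  hence "L \<le> T (Suc n)" using pos by (simp add: T_Suc field_simps)
  \<comment> \<open>If every trial were rejected, trial \<open>Suc n\<close> would be reached with a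
    constant at least \<open>L\<close>, and hence accepted.\<close>
  hence "\<exists>j. ok j" using ok_large by blast
  hence oki: "ok (i k)" and notok: "\<And>j. j < i k \<Longrightarrow> \<not> ok j"
    unfolding ik by (auto intro: LeastI_ex dest: not_less_Least)
  show s: "solves_auxiliary V Q (\<psi> k) (Ls (Suc k)) (x k) (x (Suc k))"
    unfolding L1 x1 using sol notok by blast
  show "accepted V (\<psi> k) (v k) (\<delta> k) (Ls (Suc k)) (x k) (x (Suc k))"
    using oki unfolding ok_def L1 x1 .
  show "x (Suc k) \<in> Q" using s by (simp add: solves_auxiliary_def is_arg_min_def)
  show "Ls (Suc k) > 0" using pos by (simp add: L1 T_def)
  show "Ls (Suc k) < 2 * L"
  proof (cases "i k")
    case 0
    thus ?thesis using pos less by (simp add: L1 T_def)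
  next
    case (Suc m)
    \<comment> \<open>The trial just before the accepted one was reached and rejected, so its
      constant is below \<open>L\<close>; the accepted constant is twice that.\<close>
    hence "T m < L" using ok_large notok by (metis less_SucI lessI not_le)
    moreover have "T (Suc m) = 2 * T m"
      \<comment> \<open>\<open>T 0\<close> carries the exponent -1, which \<open>T_Suc\<close> does
        not cover.\<close>
      by (cases m) (simp_all add: T_Suc, simp add: T_def)
    ultimately show ?thesis by (simp add: L1 Suc)
  qed
qed

theorem theorem5:
  fixes Q :: "'a::real_normed_vector set"
    and d f :: "'a \<Rightarrow> real"
    and L R :: real
    and \<delta> :: "nat \<Rightarrow> real"
    and \<psi> :: "nat \<Rightarrow> 'a \<Rightarrow> 'a \<Rightarrow> real"
    and v :: "nat \<Rightarrow> 'a \<Rightarrow> real"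
    and z :: "nat \<Rightarrow> nat \<Rightarrow> 'a"
    and i :: "nat \<Rightarrow> nat"
    and x :: "nat \<Rightarrow> 'a"
    and \<alpha> A Ls :: "nat \<Rightarrow> real"
    and x_star :: 'a
    and N :: nat
  defines "V \<equiv> bregman Q d"
    and "x_bar \<equiv> (1 / A N) *\<^sub>R (\<Sum>k<N. \<alpha> (Suc k) *\<^sub>R x (Suc k))"
  assumes finite_dim: "\<exists>B::'a set. finite B \<and> span B = UNIV"
    and "convex Q"
    and "convex_on Q d" "d differentiable_on Q"
    and "convex_on Q f"
    and "L > 0"
    and "\<And>k. \<delta> k \<ge> 0"
    and model: "\<And>k y. y \<in> Q \<Longrightarrow> inexact_model V Q f (\<delta> k) L y (v k y) (\<psi> k)"
    and "x 0 \<in> Q"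
    and "0 < Ls 0" "Ls 0 \<le> L"
    and nearest: "is_arg_min (V (x 0)) (is_arg_min f (\<lambda>u. u \<in> Q)) x_star"
    and "V (x 0) x_star \<le> R\<^sup>2"
    and run: "adaptive_gradient_method V Q \<delta> \<psi> v z i x \<alpha> A Ls"
    and "N \<ge> 1"
  shows "f x_bar - f x_star \<le> R\<^sup>2 / A N + (2 / A N) * (\<Sum>k<N. \<alpha> (Suc k) * \<delta> k)
       \<and> R\<^sup>2 / A N + (2 / A N) * (\<Sum>k<N. \<alpha> (Suc k) * \<delta> k)
           \<le> 2 * L * R\<^sup>2 / real N + (2 / A N) * (\<Sum>k<N. \<alpha> (Suc k) * \<delta> k)
       \<and> A N \<ge> real N / (2 * L)
       \<and> int (attempts i N) \<le> 2 * int N + \<lceil>log 2 (L / Ls 0)\<rceil>"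
proof -
  have nonneg: "V y u \<ge> 0" if "y \<in> Q" "u \<in> Q" for y u
    unfolding V_def using bregman_nonneg assms that by blast
  note step = adaptive_step[where V = V and f = f and Q = Q and L = L, OF model nonneg run]
  have inv: "x k \<in> Q \<and> 0 < Ls k \<and> Ls k < 2 * L" for k
  proof (induction k)
    case 0
    show ?case using assms by auto
  next
    case (Suc k)
    thus ?case using step(3-5)[of k] by simp
  qed
  have xQ: "x k \<in> Q" and pos: "0 < Ls k" and less: "Ls k < 2 * L" for k
    using inv[of k] by auto
  note step' = step[OF _ _ _ xQ pos less]
  have sQ: "x_star \<in> Q" using nearest by (simp add: is_arg_min_def)
  have A0: "A 0 = 0" and A_Suc: "\<And>k. A (Suc k) = A k + \<alpha> (Suc k)"
    and \<alpha>_Suc: "\<And>k. \<alpha> (Suc k) = 1 / Ls (Suc k)"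
    and Ls_Suc: "\<And>k. Ls (Suc k) = 2 powi (int (i k) - 1) * Ls k"
    using run by (simp_all add: adaptive_gradient_method_def Let_def)
  have \<alpha>_pos: "\<alpha> (Suc k) > 0" for k using pos by (simp add: \<alpha>_Suc)
  have A_sum: "A n = (\<Sum>k<n. \<alpha> (Suc k))" for n
    by (induction n) (simp_all add: A0 A_Suc)

  \<comment> \<open>One \<open>\<delta> k\<close> comes from the gap between \<open>f\<close> and
    \<open>v k\<close> at the new iterate, the other from the acceptance test. The terms in
    \<open>V (x k) (x (Suc k))\<close> cancel, and \<open>\<alpha> (Suc k)\<close> cancels the
    factor \<open>Ls (Suc k)\<close>.\<close>
  have descent: "\<alpha> (Suc k) * (f (x (Suc k)) - f x_star)
      \<le> V (x k) x_star - V (x (Suc k)) x_star + 2 * (\<alpha> (Suc k) * \<delta> k)" for k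
  proof -
    let ?M = "Ls (Suc k)" and ?u = "x (Suc k)"
    have m: "inexact_model V Q f (\<delta> k) L y (v k y) (\<psi> k)" if "y \<in> Q" for y
      using model that .
    have "\<psi> k ?u (x k) + ?M * V (x k) ?u + ?M * V ?u x_star \<le> \<psi> k x_star (x k) + ?M * V (x k) x_star"
      unfolding V_def
    proof (rule solves_auxiliary_three_point)
      show "convex_on Q (\<lambda>w. \<psi> k w (x k))" using m[OF xQ] by (simp add: inexact_model_def)
      show "solves_auxiliary (bregman Q d) Q (\<psi> k) ?M (x k) ?u"
        using step'(1) by (simp add: V_def)
    qed (use assms xQ sQ pos in auto)
    moreover have "f ?u \<le> v k ?u + \<delta> k"
      using m[OF xQ, of "Suc k"] by (simp add: inexact_model_def)
    moreover have "v k ?u \<le> v k (x k) + \<psi> k ?u (x k) + ?M * V (x k) ?u + \<delta> k"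
      using step'(2) by (simp add: accepted_def)
    moreover have "v k (x k) + \<psi> k x_star (x k) \<le> f x_star"
      using m[OF xQ] sQ by (simp add: inexact_model_def)
    ultimately have "f ?u - f x_star \<le> ?M * (V (x k) x_star - V ?u x_star) + 2 * \<delta> k"
      by (simp add: algebra_simps)
    hence "\<alpha> (Suc k) * (f ?u - f x_star)
        \<le> \<alpha> (Suc k) * (?M * (V (x k) x_star - V ?u x_star) + 2 * \<delta> k)"
      using \<alpha>_pos by (intro mult_left_mono) (auto simp: less_imp_le)
    thus ?thesis using pos[of "Suc k"] by (simp add: \<alpha>_Suc distrib_left)
  qed
  have "(\<Sum>k<N. \<alpha> (Suc k) * (f (x (Suc k)) - f x_star))
      \<le> (\<Sum>k<N. V (x k) x_star - V (x (Suc k)) x_star) + (\<Sum>k<N. 2 * (\<alpha> (Suc k) * \<delta> k))"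
    unfolding sum.distrib[symmetric] by (intro sum_mono descent)
  also have "(\<Sum>k<N. V (x k) x_star - V (x (Suc k)) x_star) = V (x 0) x_star - V (x N) x_star"
    by (rule sum_lessThan_telescope')
  \<comment> \<open>The final divergence \<open>V (x N) x_star\<close> is nonnegative and is
    dropped.\<close>
  also have "\<dots> \<le> R\<^sup>2"
    using nonneg[OF xQ sQ, of N] assms by simp
  finally have total: "(\<Sum>k<N. \<alpha> (Suc k) * (f (x (Suc k)) - f x_star))
      \<le> R\<^sup>2 + 2 * (\<Sum>k<N. \<alpha> (Suc k) * \<delta> k)"
    by (simp add: sum_distrib_left)

  have "1 / (2 * L) \<le> \<alpha> (Suc k)" for k
    using pos[of "Suc k"] less[of "Suc k"] by (simp add: \<alpha>_Suc frac_le)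
  hence "(\<Sum>k<N. 1 / (2 * L)) \<le> A N"
    unfolding A_sum by (intro sum_mono)
  hence A_ge: "real N / (2 * L) \<le> A N" by simp
  have "real N / (2 * L) > 0" using assms by simp
  hence A_pos: "A N > 0" using A_ge by linarith

  have "f x_bar \<le> (\<Sum>k<N. \<alpha> (Suc k) / A N * f (x (Suc k)))"
  proof -
    \<comment> \<open>Jensen's inequality with weights \<open>\<alpha> (Suc k) / A N\<close>, which
      sum to 1 by \<open>A_sum\<close>.\<close>
    have "f (\<Sum>k<N. (\<alpha> (Suc k) / A N) *\<^sub>R x (Suc k)) \<le> (\<Sum>k<N. \<alpha> (Suc k) / A N * f (x (Suc k)))"
    proof (rule convex_on_sum)
      show "(\<Sum>k<N. \<alpha> (Suc k) / A N) = 1"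
        using A_pos by (simp flip: sum_divide_distrib A_sum)
    qed (use assms xQ A_pos \<alpha>_pos in \<open>auto simp: less_imp_le lessThan_empty_iff\<close>)
    thus ?thesis by (simp add: x_bar_def scaleR_sum_right)
  qed
  hence "A N * f x_bar \<le> (\<Sum>k<N. \<alpha> (Suc k) * f (x (Suc k)))"
    using A_pos by (simp add: field_simps flip: sum_divide_distrib)
  hence "A N * (f x_bar - f x_star) \<le> R\<^sup>2 + 2 * (\<Sum>k<N. \<alpha> (Suc k) * \<delta> k)"
    using total by (simp add: right_diff_distrib sum_subtractf A_sum sum_distrib_right)
  hence gap: "f x_bar - f x_star \<le> R\<^sup>2 / A N + (2 / A N) * (\<Sum>k<N. \<alpha> (Suc k) * \<delta> k)"
    using A_pos by (simp add: field_simps)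

  have "R\<^sup>2 / A N \<le> R\<^sup>2 / (real N / (2 * L))"
    using A_ge A_pos assms by (intro divide_left_mono) auto
  hence rate: "R\<^sup>2 / A N \<le> 2 * L * R\<^sup>2 / real N" by (simp add: mult_ac)

  \<comment> \<open>Iteration \<open>k\<close> makes \<open>i k + 1\<close> attempts and raises the
    logarithm by \<open>i k - 1\<close>, that is, by its number of attempts minus 2.\<close>
  have Ls_log: "log 2 (Ls n) = log 2 (Ls 0) + (real (attempts i n) - 2 * real n)" for n
  proof (induction n)
    case 0
    show ?case by (simp add: attempts_def)
  next
    case (Suc n)
    have "log 2 (Ls (Suc n)) = (real (i n) - 1) + log 2 (Ls n)"
      using pos[of n] by (simp add: Ls_Suc log_mult log_of_power_eq flip: powr_real_of_int')
    thus ?case using Suc by (simp add: attempts_def)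
  qed
  have "log 2 (Ls N) < log 2 (2 * L)"
    using pos[of N] less[of N] \<open>L > 0\<close> by (subst log_less_cancel_iff) auto
  hence "real (attempts i N) - 2 * real N < 1 + log 2 (L / Ls 0)"
    using Ls_log[of N] assms by (simp add: log_mult log_divide)
  \<comment> \<open>An integer strictly below 1 + r is at most the ceiling of r; this is where the
    strictness of \<open>Ls N < 2 * L\<close> matters.\<close>
  hence "int (attempts i N) \<le> 2 * int N + \<lceil>log 2 (L / Ls 0)\<rceil>"
    by linarith
  thus ?thesis using gap rate A_ge by simp
qed

end
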